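(* Let $(X,d)$ be a complete metric space and let $u\in BC(\mathbb{R},X)$. The following statements are equivalent. (i) $u\in AP(\mathbb{R},X)$, i.e. $u$ is almost periodic. (ii) The set $\{T_\tau u : \tau\ge 0\}$ is relatively compact in $(BC(\mathbb{R},X),d_\infty)$. (iii) The set $\{R(T_\tau u) : \tau\in\mathbb{R}\}$ is relatively compact in $(BC(\mathbb{R}^+,X),d_{\infty,+})$.
   Context: $\mathbb{R}^+=[0,+\infty)$. For a metric space $(X,d)$ and $J=\mathbb{R}$ or $J=\mathbb{R}^+$, $BC(J,X)$ is the space of all bounded continuous functions from $J$ to $X$, with the metric $d_\infty(u,v)=\sup_{t\in\mathbb{R}}d(u(t),v(t))$ when $J=\mathbb{R}$, and $d_{\infty,+}(u,v)=\sup_{t\ge 0}d(u(t),v(t))$ when $J=\mathbb{R}^+$. For $\tau\in\mathbb{R}$ and $u\in BC(\mathbb{R},X)$, the translate $T_\tau u\in BC(\mathbb{R},X)$ is $T_\tau u(t)=u(t+\tau)$, $t\in\mathbb{R}$. The restriction operator $R:BC(\mathbb{R},X)\to BC(\mathbb{R}^+,X)$ is $R(u)(t)=u(t)$ for $t\ge 0$. A subset $D\subset\mathbb{R}$ is relatively dense in $\mathbb{R}$ if there is $\ell>0$ such that $D\cap[\alpha,\alpha+\ell]\neq\emptyset$ for all $\alpha\in\mathbb{R}$. A continuous function $u:\mathbb{R}\to X$ is almost periodic (in the sense of Bohr) if for each $\varepsilon>0$ the set $\{\tau\in\mathbb{R} : \sup_{t\in\mathbb{R}}d(u(t+\tau),u(t))\le\varepsilon\}$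 is relatively dense in $\mathbb{R}$; $AP(\mathbb{R},X)$ denotes the set of such functions. A subset of a metric space is relatively compact if its closure is compact. *)

theory Defs
  imports "HOL-Analysis.Analysis"
begin

text \<open>
  The library's \<^const>\<open>cfunspace\<close> carries the sup metric (a real-valued supremum, well defined
  because its members are bounded). Its members are extensional: they take the value
  \<^const>\<open>undefined\<close> outside \<open>J\<close>, so elements of \<open>BC J m\<close> are exactly functions on \<open>J\<close>.
\<close>

definition BC :: "real set \<Rightarrow> 'a metric \<Rightarrow> (real \<Rightarrow> 'a) metric" where
  "BC J m = cfunspace (top_of_set J) m"

lemma mspace_BC:
  "mspace (BC J m) =
     {f. f \<in> J \<rightarrow> mspace m \<and> f \<in> extensional J \<and>
         Metric_space.mbounded (mspace m) (mdist m) (f ` J) \<and>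
         continuous_map (top_of_set J) (mtopology_of m) f}"
  by (simp add: BC_def)

lemma mdist_BC:
  assumes "f \<in> mspace (BC J m)" "g \<in> mspace (BC J m)" "J \<noteq> {}"
  shows "mdist (BC J m) f g = (SUP t\<in>J. mdist m (f t) (g t))"
proof -
  interpret Metric_space "mspace m" "mdist m" by simp
  show ?thesis
    using assms
    by (auto simp: BC_def cfunspace_def mdist_funspace fdist_def fspace_def)
qed

definition translate :: "real \<Rightarrow> (real \<Rightarrow> 'a) \<Rightarrow> real \<Rightarrow> 'a" where
  "translate \<tau> u = (\<lambda>t. u (t + \<tau>))"

definition restrict_nonneg :: "(real \<Rightarrow> 'a) \<Rightarrow> real \<Rightarrow> 'a" where
  "restrict_nonneg u = restrict u {0..}"

definition relatively_dense :: "real set \<Rightarrow> bool" where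
  "relatively_dense D \<longleftrightarrow> (\<exists>l>0. \<forall>\<alpha>. D \<inter> {\<alpha>..\<alpha> + l} \<noteq> {})"

text \<open>
  Almost periodic functions are only assumed continuous, so the supremum may be infinite a priori;
  it is therefore taken in the extended reals.
\<close>

definition AP :: "'a metric \<Rightarrow> (real \<Rightarrow> 'a) set" where
  "AP m = {u. continuous_map euclidean (mtopology_of m) u \<and>
     (\<forall>\<epsilon>>0. relatively_dense
        {\<tau>. (SUP t. ereal (mdist m (u (t + \<tau>)) (u t))) \<le> ereal \<epsilon>})}"

definition relatively_compactin :: "'a topology \<Rightarrow> 'a set \<Rightarrow> bool" where
  "relatively_compactin T S \<longleftrightarrow> S \<subseteq> topspace T \<and> compactin T (T closure_of S)"

end

theory Submission
  imports Defs
begin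

text \<open>
  The spaces \<open>BC J m\<close> are complete because \<open>m\<close> is, so relative compactness is total boundedness there, and each of
  the conditions becomes a statement about finite nets of translates. For \<open>I\<close> the set of shifts and
  \<open>J\<close> the set of times on which translates are compared, \<open>translates_totally_bounded m u J I\<close> says
  that for every \<open>e > 0\<close> finitely many shifts \<open>f \<in> I\<close> suffice to approximate every \<open>u (_ + \<tau>)\<close> with
  \<open>\<tau> \<in> I\<close> by some \<open>u (_ + f)\<close> up to \<open>e\<close>, uniformly on \<open>J\<close>. Condition (ii) is the case where \<open>J\<close> is
  the line and \<open>I\<close> the half-line, (iii) is the case where \<open>I\<close> is the line and \<open>J\<close> the half-line. The
  strongest case, where both are the line, links everything:

  \<^item> An almost periodic \<open>u\<close> has a translation net for all real shifts: an almost period moves any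
    shift into a fixed compact interval, and \<open>u\<close> is uniformly continuous, so a fine grid of that
    interval is a net. The cases (ii) and (iii) follow by restricting shifts or times.

  \<^item> Given a finite net \<open>F\<close> for the nonnegative shifts, a shift \<open>\<tau>\<close> and a net point \<open>f\<close> near it differ
    by an almost period, because the sup distance over the line depends only on \<open>\<tau> - f\<close>. Hence almost
    periods occur in every interval of length \<open>Max F\<close>, which is almost periodicity.

  \<^item> The heart is the passage from (iii) to the two-sided case. The distance between two shifts
    over the times \<open>t \<ge> 0\<close> can only grow when both shifts are decreased by the same \<open>h \<ge> 0\<close>, and it tends
    to the two-sided distance as \<open>h\<close> tends to infinity. Under (iii) the finite sets of shifts whose
    forward distances exceed \<open>e\<close> have bounded cardinality. Let \<open>A\<close> be one of maximal cardinality. Were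
    some \<open>\<tau>\<close> farther than \<open>e\<close> from all of \<open>A\<close> in the two-sided distance, then for \<open>h\<close> large the set
    \<open>{\<tau>} \<union> A\<close> decreased by \<open>h\<close> would be forward separated and larger than \<open>A\<close>. So \<open>A\<close> is a two-sided net.
\<close>

section \<open>Finite nets of translates\<close>

definition translation_net ::
  "'a metric \<Rightarrow> (real \<Rightarrow> 'a) \<Rightarrow> real set \<Rightarrow> real set \<Rightarrow> real \<Rightarrow> real set \<Rightarrow> bool" where
  "translation_net m u J I e F \<longleftrightarrow> finite F \<and> F \<subseteq> I \<and>
     (\<forall>\<tau>\<in>I. \<exists>f\<in>F. \<forall>t\<in>J. mdist m (u (t + \<tau>)) (u (t + f)) \<le> e)"

lemma translation_netI:
  assumes "finite F" "F \<subseteq> I"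
    "\<And>\<tau>. \<tau> \<in> I \<Longrightarrow> \<exists>f\<in>F. \<forall>t\<in>J. mdist m (u (t + \<tau>)) (u (t + f)) \<le> e"
  shows "translation_net m u J I e F"
  using assms by (simp add: translation_net_def)

lemma translation_netD:
  assumes "translation_net m u J I e F"
  shows "finite F" "F \<subseteq> I"
    "\<tau> \<in> I \<Longrightarrow> \<exists>f\<in>F. \<forall>t\<in>J. mdist m (u (t + \<tau>)) (u (t + f)) \<le> e"
  using assms by (simp_all add: translation_net_def)

definition translates_totally_bounded ::
  "'a metric \<Rightarrow> (real \<Rightarrow> 'a) \<Rightarrow> real set \<Rightarrow> real set \<Rightarrow> bool" where
  "translates_totally_bounded m u J I \<longleftrightarrow> (\<forall>e>0. \<exists>F. translation_net m u J I e F)"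

section \<open>Relative compactness as total boundedness\<close>

lemma BC_in_mspace: "u \<in> mspace (BC UNIV m) \<Longrightarrow> u t \<in> mspace m"
  by (auto simp: mspace_BC)

lemma restrict_translate_in_BC:
  assumes "u \<in> mspace (BC UNIV m)"
  shows "restrict (translate \<tau> u) J \<in> mspace (BC J m)"
proof -
  interpret Metric_space "mspace m" "mdist m" by simp
  have u: "range u \<subseteq> mspace m" "mbounded (range u)"
    "continuous_map euclidean (mtopology_of m) u"
    using assms by (auto simp: mspace_BC)
  have "continuous_on J (\<lambda>t. t + \<tau>)"
    by (intro continuous_intros)
  then have "continuous_map (top_of_set J) euclidean (\<lambda>t. t + \<tau>)"
    by simp
  then have "continuous_map (top_of_set J) (mtopology_of m) (translate \<tau> u)"
    using continuous_map_compose[OF _ u(3), of "top_of_set J" "\<lambda>t. t + \<tau>"]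
    by (simp add: translate_def[abs_def] o_def)
  then have "continuous_map (top_of_set J) (mtopology_of m) (restrict (translate \<tau> u) J)"
    by (rule continuous_map_eq) auto
  moreover have "mbounded (restrict (translate \<tau> u) J ` J)"
    by (rule mbounded_subset[OF u(2)]) (auto simp: translate_def)
  ultimately show ?thesis
    using u(1) by (auto simp: mspace_BC translate_def)
qed

lemma mdist_BC_le_iff:
  assumes "f \<in> mspace (BC J m)" "g \<in> mspace (BC J m)" "J \<noteq> {}"
  shows "mdist (BC J m) f g \<le> e \<longleftrightarrow> (\<forall>t\<in>J. mdist m (f t) (g t) \<le> e)"
  using assms cfunspace_mdist_le[of f "top_of_set J" m g e] by (simp add: BC_def)

lemma mcomplete_BC:
  assumes "mcomplete_of m"
  shows "mcomplete_of (BC J m)"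
proof -
  interpret Metric_space "mspace m" "mdist m" by simp
  have "mcomplete" using assms by (simp add: mcomplete_of_def)
  from mcomplete_cfunspace[OF this, of "top_of_set J"] show ?thesis
    by (simp add: BC_def Self_def)
qed

text \<open>
  In a complete space relative compactness is total boundedness, and a bound on the sup metric is a
  uniform pointwise bound.
\<close>

lemma relatively_compactin_translates_iff:
  assumes "mcomplete_of m" "u \<in> mspace (BC UNIV m)" "J \<noteq> {}"
  shows "relatively_compactin (mtopology_of (BC J m))
           ((\<lambda>\<tau>. restrict (translate \<tau> u) J) ` I) \<longleftrightarrow> translates_totally_bounded m u J I"
proof -
  let ?g = "\<lambda>\<tau>. restrict (translate \<tau> u) J"
  interpret B: Metric_space "mspace (BC J m)" "mdist (BC J m)" by simp
  have g: "?g \<tau> \<in> mspace (BC J m)" for \<tau>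
    using restrict_translate_in_BC[OF assms(2)] .
  have le: "mdist (BC J m) (?g a) (?g b) \<le> e \<longleftrightarrow>
      (\<forall>t\<in>J. mdist m (u (t + a)) (u (t + b)) \<le> e)" for a b e
    using mdist_BC_le_iff[OF g g assms(3)] by (simp add: translate_def)
  have "relatively_compactin (mtopology_of (BC J m)) (?g ` I) \<longleftrightarrow> B.mtotally_bounded (?g ` I)"
    using B.mtotally_bounded_eq_compact_closure_of[of "?g ` I"] mcomplete_BC[OF assms(1), of J]
    by (simp add: relatively_compactin_def mcomplete_of_def mtopology_of_def)
  also have "\<dots> \<longleftrightarrow> translates_totally_bounded m u J I"
  proof
    assume L: "B.mtotally_bounded (?g ` I)"
    show "translates_totally_bounded m u J I"
      unfolding translates_totally_bounded_def
    proof (intro allI impI)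
      fix e :: real assume "e > 0"
      then obtain K where K: "finite K" "K \<subseteq> ?g ` I" "?g ` I \<subseteq> (\<Union>x\<in>K. B.mball x e)"
        using L unfolding B.mtotally_bounded_def by meson
      obtain F where F: "F \<subseteq> I" "finite F" "K = ?g ` F"
        using finite_subset_image[OF K(1,2)] by blast
      have "\<exists>f\<in>F. \<forall>t\<in>J. mdist m (u (t + \<tau>)) (u (t + f)) \<le> e" if "\<tau> \<in> I" for \<tau>
      proof -
        obtain f where "f \<in> F" "mdist (BC J m) (?g f) (?g \<tau>) < e"
          using K(3) F(3) \<open>\<tau> \<in> I\<close> B.in_mball by blast
        then have "mdist (BC J m) (?g \<tau>) (?g f) \<le> e"
          by (simp add: B.commute)
        with \<open>f \<in> F\<close> le show ?thesis by blast
      qed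
      with F(2,1) have "translation_net m u J I e F"
        by (rule translation_netI)
      then show "\<exists>F. translation_net m u J I e F" ..
    qed
  next
    assume R: "translates_totally_bounded m u J I"
    show "B.mtotally_bounded (?g ` I)"
      unfolding B.mtotally_bounded_def
    proof (intro allI impI)
      fix e :: real assume "e > 0"
      then have "e / 2 > 0" by simp
      obtain F where "translation_net m u J I (e / 2) F"
        using R \<open>e / 2 > 0\<close> unfolding translates_totally_bounded_def by blast
      note F = translation_netD[OF this]
      have "?g \<tau> \<in> (\<Union>x\<in>?g ` F. B.mball x e)" if "\<tau> \<in> I" for \<tau>
      proof -
        obtain f where "f \<in> F" "mdist (BC J m) (?g \<tau>) (?g f) \<le> e / 2"
          using F(3)[OF \<open>\<tau> \<in> I\<close>] le by blast
        then have "mdist (BC J m) (?g f) (?g \<tau>) < e"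
          using \<open>e > 0\<close> B.commute[of "?g \<tau>" "?g f"] by linarith
        with \<open>f \<in> F\<close> g show ?thesis by auto
      qed
      with F(1,2) show "\<exists>K. finite K \<and> K \<subseteq> ?g ` I \<and> ?g ` I \<subseteq> (\<Union>x\<in>K. B.mball x e)"
        by (intro exI[of _ "?g ` F"]) blast
    qed
  qed
  finally show ?thesis .
qed

section \<open>Almost periods\<close>

definition almost_periods :: "'a metric \<Rightarrow> (real \<Rightarrow> 'a) \<Rightarrow> real \<Rightarrow> real set" where
  "almost_periods m u e = {\<tau>. \<forall>t. mdist m (u (t + \<tau>)) (u t) \<le> e}"

text \<open>
  The extended-real supremum in the definition of \<^const>\<open>AP\<close> is bounded by \<open>e\<close> exactly if all its
  terms are.
\<close>

lemma AP_iff_almost_periods: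
  assumes "u \<in> mspace (BC UNIV m)"
  shows "u \<in> AP m \<longleftrightarrow> (\<forall>e>0. relatively_dense (almost_periods m u e))"
  using assms by (simp add: AP_def almost_periods_def mspace_BC SUP_le_iff)

text \<open>
  The distance of two translates over the whole line depends only on the difference of the shifts;
  this fails over a half-line, which is what makes the condition on restrictions the delicate one.
\<close>

lemma almost_periods_diff:
  assumes "\<forall>t. mdist m (u (t + a)) (u (t + b)) \<le> e"
  shows "a - b \<in> almost_periods m u e" "b - a \<in> almost_periods m u e"
proof -
  interpret Metric_space "mspace m" "mdist m" by simp
  show "a - b \<in> almost_periods m u e"
    unfolding almost_periods_def
  proof clarify
    fix t show "mdist m (u (t + (a - b))) (u t) \<le> e"
      using assms[rule_format, of "t - b"] by (simp add: algebra_simps)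
  qed
  show "b - a \<in> almost_periods m u e"
    unfolding almost_periods_def
  proof clarify
    fix t show "mdist m (u (t + (b - a))) (u t) \<le> e"
      using assms[rule_format, of "t - a"] by (simp add: algebra_simps commute)
  qed
qed

lemma almost_periods_shift:
  assumes "a - b \<in> almost_periods m u e"
  shows "mdist m (u (t + a)) (u (t + b)) \<le> e"
proof -
  have "mdist m (u ((t + b) + (a - b))) (u (t + b)) \<le> e"
    using assms unfolding almost_periods_def by blast
  then show ?thesis by (simp add: add.commute)
qed

text \<open>
  An almost period carries any two neighbouring points into one fixed compact interval, where
  continuity is uniform.
\<close>

lemma AP_imp_uniformly_continuous:
  assumes "u \<in> AP m" "u \<in> mspace (BC UNIV m)" "e > 0"
  obtains \<delta> where "\<delta> > 0" "\<And>s t. \<bar>s - t\<bar> < \<delta> \<Longrightarrow> mdist m (u s) (u t) \<le> e"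
proof -
  interpret Metric_space "mspace m" "mdist m" by simp
  have M: "u t \<in> mspace m" for t
    using BC_in_mspace[OF assms(2)] .
  have "e / 3 > 0" using \<open>e > 0\<close> by simp
  then have "relatively_dense (almost_periods m u (e/3))"
    using assms AP_iff_almost_periods by blast
  then obtain l where "l > 0"
    and l: "\<And>\<alpha>. almost_periods m u (e/3) \<inter> {\<alpha>..\<alpha> + l} \<noteq> {}"
    unfolding relatively_dense_def by blast
  \<comment> \<open>The almost period is chosen to carry \<open>t\<close> into \<open>[0, l]\<close>; a point within distance 1 of \<open>t\<close>
      then lands in this slightly larger interval.\<close>
  let ?K = "{-1..l+1}"
  have cont: "continuous_map (top_of_set ?K) (mtopology_of m) u"
    using assms(2) by (simp add: mspace_BC continuous_map_from_subtopology)
  have "uniformly_continuous_map (submetric euclidean_metric ?K) m u"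
  proof (rule continuous_imp_uniformly_continuous_map)
    show "compact_space (mtopology_of (submetric euclidean_metric ?K)) \<and>
        continuous_map (mtopology_of (submetric euclidean_metric ?K)) (mtopology_of m) u"
      using cont by (simp add: mtopology_of_submetric compact_space_subtopology)
  qed
  then have "\<exists>\<delta>>0. \<forall>x\<in>?K. \<forall>y\<in>?K. dist y x < \<delta> \<longrightarrow> mdist m (u y) (u x) < e/3"
    using \<open>e / 3 > 0\<close> unfolding uniformly_continuous_map_def
    by (simp del: atLeastAtMost_iff less_divide_eq_numeral1)
  then obtain \<delta> where "\<delta> > 0" and
    \<delta>: "\<And>x y. x \<in> ?K \<Longrightarrow> y \<in> ?K \<Longrightarrow> dist y x < \<delta> \<Longrightarrow> mdist m (u y) (u x) < e/3"
    by blast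
  show thesis
  proof (rule that[of "min \<delta> 1"])
    show "min \<delta> 1 > 0" using \<open>\<delta> > 0\<close> by simp
    fix s t :: real assume st: "\<bar>s - t\<bar> < min \<delta> 1"
    obtain \<tau> where \<tau>: "\<tau> \<in> almost_periods m u (e/3)" "-t \<le> \<tau>" "\<tau> \<le> -t + l"
      using l[of "-t"] by auto
    have "mdist m (u (s + \<tau>)) (u (t + \<tau>)) < e/3"
      using st \<tau> by (intro \<delta>) (auto simp: dist_real_def)
    moreover have "mdist m (u (s + \<tau>)) (u s) \<le> e/3" "mdist m (u (t + \<tau>)) (u t) \<le> e/3"
      using \<tau>(1) unfolding almost_periods_def by auto
    moreover have "mdist m (u s) (u t) \<le> mdist m (u s) (u (s + \<tau>)) + mdist m (u (s + \<tau>)) (u t)"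
      "mdist m (u (s + \<tau>)) (u t) \<le> mdist m (u (s + \<tau>)) (u (t + \<tau>)) + mdist m (u (t + \<tau>)) (u t)"
      using triangle M by blast+
    ultimately show "mdist m (u s) (u t) \<le> e"
      using commute[of "u s" "u (s + \<tau>)"] by linarith
  qed
qed

text \<open>
  Subtracting an almost period from a shift brings it into \<open>[0, l]\<close>, and by uniform continuity the
  shifts in this compact interval have a finite net.
\<close>

lemma AP_imp_translates_totally_bounded:
  assumes "u \<in> AP m" "u \<in> mspace (BC UNIV m)"
  shows "translates_totally_bounded m u UNIV UNIV"
  unfolding translates_totally_bounded_def
proof (intro allI impI)
  interpret Metric_space "mspace m" "mdist m" by simp
  fix e :: real assume "e > 0"
  then have "e / 2 > 0" by simp
  have M: "u t \<in> mspace m" for t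
    using BC_in_mspace[OF assms(2)] .
  obtain \<delta> where "\<delta> > 0" and \<delta>: "\<And>s t. \<bar>s - t\<bar> < \<delta> \<Longrightarrow> mdist m (u s) (u t) \<le> e/2"
    using AP_imp_uniformly_continuous[OF assms \<open>e / 2 > 0\<close>] by blast
  have "relatively_dense (almost_periods m u (e/2))"
    using assms AP_iff_almost_periods \<open>e / 2 > 0\<close> by blast
  then obtain l where "l > 0"
    and l: "\<And>\<alpha>. almost_periods m u (e/2) \<inter> {\<alpha>..\<alpha> + l} \<noteq> {}"
    unfolding relatively_dense_def by blast
  obtain F where F: "finite F" "{0..l} \<subseteq> (\<Union>x\<in>F. ball x \<delta>)"
    using compact_eq_totally_bounded[of "{0..l}"] \<open>\<delta> > 0\<close> by auto
  have "\<exists>f\<in>F. \<forall>t. mdist m (u (t + \<tau>)) (u (t + f)) \<le> e" for \<tau>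
  proof -
    obtain p where p: "p \<in> almost_periods m u (e/2)" "\<tau> - l \<le> p" "p \<le> \<tau>"
      using l[of "\<tau> - l"] by auto
    then have "\<tau> - p \<in> {0..l}" by auto
    then obtain f where "f \<in> F" "\<tau> - p \<in> ball f \<delta>"
      using F(2) by blast
    then have f: "f \<in> F" "\<bar>(\<tau> - p) - f\<bar> < \<delta>"
      by (simp_all add: dist_real_def abs_minus_commute)
    have "mdist m (u (t + \<tau>)) (u (t + f)) \<le> e" for t
    proof -
      have "mdist m (u (t + \<tau>)) (u (t + (\<tau> - p))) \<le> e/2"
        using p(1) by (intro almost_periods_shift) simp
      moreover have "mdist m (u (t + (\<tau> - p))) (u (t + f)) \<le> e/2"
        using f(2) by (intro \<delta>) simp
      moreover have "mdist m (u (t + \<tau>)) (u (t + f))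
          \<le> mdist m (u (t + \<tau>)) (u (t + (\<tau> - p))) + mdist m (u (t + (\<tau> - p))) (u (t + f))"
        using triangle M by blast
      ultimately show ?thesis by linarith
    qed
    with f(1) show ?thesis by blast
  qed
  with F(1) have "translation_net m u UNIV UNIV e F"
    by (intro translation_netI) auto
  then show "\<exists>F. translation_net m u UNIV UNIV e F" by blast
qed

text \<open>
  A net for \<open>I\<close> need not lie in \<open>I'\<close>. Each net point that approximates some shift of \<open>I'\<close> is
  therefore replaced by one such shift, which at most doubles the error.
\<close>

lemma translates_totally_bounded_mono:
  assumes "translates_totally_bounded m u J I" "I' \<subseteq> I" "\<And>t. u t \<in> mspace m" "J' \<subseteq> J"
  shows "translates_totally_bounded m u J' I'"
  unfolding translates_totally_bounded_def
proof (intro allI impI)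
  interpret Metric_space "mspace m" "mdist m" by simp
  fix e :: real assume "e > 0"
  then have "e / 2 > 0" by simp
  obtain F where "translation_net m u J I (e/2) F"
    using assms(1) \<open>e / 2 > 0\<close> unfolding translates_totally_bounded_def by blast
  note F = translation_netD[OF this]
  define near where "near f \<tau> \<longleftrightarrow> \<tau> \<in> I' \<and> (\<forall>t\<in>J. mdist m (u (t + \<tau>)) (u (t + f)) \<le> e/2)" for f \<tau>
  define c where "c f = (SOME \<tau>. near f \<tau>)" for f
  let ?G = "c ` {f \<in> F. \<exists>\<tau>. near f \<tau>}"
  have c: "near f (c f)" if "near f \<tau>" for f \<tau>
    unfolding c_def using that by (rule someI)
  have "finite ?G" using F(1) by simp
  moreover have "?G \<subseteq> I'" using c by (auto simp: near_def)
  moreover have "\<exists>g\<in>?G. \<forall>t\<in>J'. mdist m (u (t + \<tau>)) (u (t + g)) \<le> e" if "\<tau> \<in> I'" for \<tau>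
  proof -
    have "\<tau> \<in> I" using assms(2) that by blast
    from F(3)[OF this] obtain f where f: "f \<in> F" "near f \<tau>"
      using \<open>\<tau> \<in> I'\<close> unfolding near_def by blast
    have "mdist m (u (t + \<tau>)) (u (t + c f)) \<le> e" if "t \<in> J'" for t
    proof -
      have "mdist m (u (t + \<tau>)) (u (t + f)) \<le> e/2" "mdist m (u (t + c f)) (u (t + f)) \<le> e/2"
        using f(2) c[OF f(2)] that assms(4) unfolding near_def by auto
      moreover have "mdist m (u (t + \<tau>)) (u (t + c f))
          \<le> mdist m (u (t + \<tau>)) (u (t + f)) + mdist m (u (t + f)) (u (t + c f))"
        using triangle assms(3) by blast
      ultimately show ?thesis
        using commute[of "u (t + f)" "u (t + c f)"] by linarith
    qed
    with f show ?thesis by blast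
  qed
  ultimately have "translation_net m u J' I' e ?G"
    by (rule translation_netI)
  then show "\<exists>F. translation_net m u J' I' e F" by blast
qed

text \<open>
  A shift minus a nearby net point is an almost period, so almost periods lie within \<open>Max F\<close> of every
  nonnegative shift. The set of almost periods is symmetric, which covers the negative half-line.
\<close>

lemma nonneg_translates_totally_bounded_imp_AP:
  assumes "translates_totally_bounded m u UNIV {0..}" "u \<in> mspace (BC UNIV m)"
  shows "u \<in> AP m"
  unfolding AP_iff_almost_periods[OF assms(2)]
proof (intro allI impI)
  fix e :: real assume "e > 0"
  obtain F where "translation_net m u UNIV {0..} e F"
    using assms(1) \<open>e > 0\<close> unfolding translates_totally_bounded_def by blast
  note F = translation_netD[OF this]
  \<comment> \<open>Inserting 1 makes \<open>l\<close> positive even if \<open>F\<close> is \<open>{0}\<close>.\<close>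
  define l where "l = Max (insert 1 F)"
  have l: "l > 0" "\<And>f. f \<in> F \<Longrightarrow> f \<le> l"
    using F(1) less_le_trans[OF zero_less_one Max_ge[of "insert 1 F" 1]]
    by (simp_all add: l_def del: Max_insert)
  have "almost_periods m u e \<inter> {\<alpha>..\<alpha> + l} \<noteq> {}" for \<alpha>
  proof (cases "\<alpha> \<ge> 0")
    case True
    then have "\<alpha> + l \<in> {0..}" using l(1) by simp
    then obtain f where f: "f \<in> F" "\<forall>t. mdist m (u (t + (\<alpha> + l))) (u (t + f)) \<le> e"
      using F(3) by blast
    have "\<alpha> + l - f \<in> {\<alpha>..\<alpha> + l}" using f(1) F(2) l(2) by auto
    with almost_periods_diff(1)[OF f(2)] show ?thesis by blast
  next
    case False
    then have "- \<alpha> \<in> {0..}" by simp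
    then obtain f where f: "f \<in> F" "\<forall>t. mdist m (u (t + - \<alpha>)) (u (t + f)) \<le> e"
      using F(3) by blast
    have "f - - \<alpha> \<in> {\<alpha>..\<alpha> + l}" using f(1) F(2) l(2) by auto
    with almost_periods_diff(2)[OF f(2)] show ?thesis by blast
  qed
  with l(1) show "relatively_dense (almost_periods m u e)"
    unfolding relatively_dense_def by blast
qed

section \<open>From forward nets to two-sided nets\<close>

definition forward_separated :: "'a metric \<Rightarrow> (real \<Rightarrow> 'a) \<Rightarrow> real \<Rightarrow> real set \<Rightarrow> bool" where
  "forward_separated m u e A \<longleftrightarrow>
     (\<forall>a\<in>A. \<forall>b\<in>A. a \<noteq> b \<longrightarrow> (\<exists>t\<ge>0. mdist m (u (t + a)) (u (t + b)) > e))"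

text \<open>
  Two separated shifts cannot be close to the same net point, so the choice of a nearby net point
  injects \<open>A\<close> into \<open>F\<close>.
\<close>

lemma card_forward_separated_le:
  assumes "forward_separated m u e A" "finite F" "\<And>t. u t \<in> mspace m"
    and F: "\<And>\<tau>. \<exists>f\<in>F. \<forall>t\<in>{0..}. mdist m (u (t + \<tau>)) (u (t + f)) \<le> e/2"
  shows "card A \<le> card F"
proof -
  interpret Metric_space "mspace m" "mdist m" by simp
  obtain c where c: "\<And>\<tau>. c \<tau> \<in> F"
    "\<And>\<tau> t. t \<ge> 0 \<Longrightarrow> mdist m (u (t + \<tau>)) (u (t + c \<tau>)) \<le> e/2"
    using F by (metis atLeast_iff)
  have "inj_on c A"
  proof (rule inj_onI, rule ccontr)
    fix a b assume ab: "a \<in> A" "b \<in> A" "c a = c b" "a \<noteq> b"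
    then obtain t where t: "t \<ge> 0" "mdist m (u (t + a)) (u (t + b)) > e"
      using assms(1) unfolding forward_separated_def by blast
    have "mdist m (u (t + a)) (u (t + b))
        \<le> mdist m (u (t + a)) (u (t + c a)) + mdist m (u (t + c a)) (u (t + b))"
      using triangle assms(3) by blast
    moreover have "mdist m (u (t + a)) (u (t + c a)) \<le> e/2" "mdist m (u (t + b)) (u (t + c a)) \<le> e/2"
      using c(2)[OF t(1), of a] c(2)[OF t(1), of b] ab(3) by simp_all
    ultimately show False using t(2) commute[of "u (t + c a)" "u (t + b)"] by linarith
  qed
  then show ?thesis using card_inj_on_le[of c A F] c(1) assms(2) by blast
qed

text \<open>
  A separated set of maximal cardinality remains separated, hence of maximal cardinality, when all
  its points are decreased by the same amount. Decreasing the shifts by \<open>h\<close> amounts to comparing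
  over \<open>t \<ge> - h\<close>, so maximality for every \<open>h\<close> gives a net over the whole line.
\<close>

lemma forward_imp_two_sided_totally_bounded:
  assumes "translates_totally_bounded m u {0..} UNIV" "\<And>t. u t \<in> mspace m"
  shows "translates_totally_bounded m u UNIV UNIV"
  unfolding translates_totally_bounded_def
proof (intro allI impI)
  interpret Metric_space "mspace m" "mdist m" by simp
  fix e :: real assume "e > 0"
  then have "e / 2 > 0" by simp
  obtain F where "translation_net m u {0..} UNIV (e/2) F"
    using assms(1) \<open>e / 2 > 0\<close> unfolding translates_totally_bounded_def by blast
  note F = translation_netD[OF this]
  let ?P = "\<lambda>A. finite A \<and> forward_separated m u e A"
  have "?P {}" by (simp add: forward_separated_def)
  moreover have "\<forall>A. ?P A \<longrightarrow> card A < Suc (card F)"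
    using card_forward_separated_le[OF _ F(1) assms(2) F(3)[OF UNIV_I]] by (simp add: less_Suc_eq_le)
  ultimately obtain A where A: "finite A" "forward_separated m u e A"
    and max: "\<And>B. finite B \<Longrightarrow> forward_separated m u e B \<Longrightarrow> card B \<le> card A"
    using ex_has_greatest_nat[of ?P "{}" card "Suc (card F)"] by blast
  have "\<exists>a\<in>A. \<forall>t. mdist m (u (t + \<tau>)) (u (t + a)) \<le> e" for \<tau>
  proof (rule ccontr)
    assume "\<not> ?thesis"
    then obtain s where s: "\<And>a. a \<in> A \<Longrightarrow> mdist m (u (s a + \<tau>)) (u (s a + a)) > e"
      by (metis not_le)
    have "\<tau> \<notin> A"
    proof
      assume "\<tau> \<in> A"
      from s[OF this] show False using \<open>e > 0\<close> assms(2) by simp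
    qed
    \<comment> \<open>Large enough that all times witnessing the distance from \<open>\<tau>\<close> to a point of \<open>A\<close> become
        nonnegative after adding \<open>h\<close>.\<close>
    define h where "h = Max (insert 0 ((\<lambda>a. - s a) ` A))"
    have h: "h \<ge> 0" "\<And>a. a \<in> A \<Longrightarrow> s a + h \<ge> 0"
    proof -
      show "h \<ge> 0" using A(1) by (simp add: h_def)
      fix a assume "a \<in> A"
      then have "- s a \<le> h" using A(1) by (auto simp: h_def intro!: Max_ge)
      then show "s a + h \<ge> 0" by simp
    qed
    let ?B = "(\<lambda>x. x - h) ` insert \<tau> A"
    have far: "\<exists>t. t + h \<ge> 0 \<and> mdist m (u (t + x)) (u (t + y)) > e"
      if xy: "x \<in> insert \<tau> A" "y \<in> insert \<tau> A" "x \<noteq> y" for x y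
    proof -
      consider "x = \<tau>" "y \<in> A" | "x \<in> A" "y = \<tau>" | "x \<in> A" "y \<in> A"
        using xy by blast
      then show ?thesis
      proof cases
        case 1
        then show ?thesis using s h(2) by blast
      next
        case 2
        then show ?thesis using s h(2) commute by metis
      next
        case 3
        then obtain t where "t \<ge> 0" "mdist m (u (t + x)) (u (t + y)) > e"
          using A(2) xy(3) unfolding forward_separated_def by blast
        then show ?thesis using h(1) by (meson add_nonneg_nonneg)
      qed
    qed
    have "forward_separated m u e ?B"
      unfolding forward_separated_def
    proof clarify
      fix x y assume xy: "x \<in> insert \<tau> A" "y \<in> insert \<tau> A" "x - h \<noteq> y - h"
      then obtain t where t: "t + h \<ge> 0" "mdist m (u (t + x)) (u (t + y)) > e"
        using far by blast
      then show "\<exists>t\<ge>0. mdist m (u (t + (x - h))) (u (t + (y - h))) > e"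
        by (intro exI[of _ "t + h"]) simp
    qed
    moreover have "card ?B = Suc (card A)"
      using A(1) \<open>\<tau> \<notin> A\<close> by (subst card_image) (auto simp: inj_on_def)
    ultimately show False using max[of ?B] A(1) by simp
  qed
  with A(1) have "translation_net m u UNIV UNIV e A"
    by (intro translation_netI) auto
  then show "\<exists>F. translation_net m u UNIV UNIV e F" by blast
qed

theorem theorem3p1:
  fixes m :: "'a metric" and u :: "real \<Rightarrow> 'a"
  assumes "mcomplete_of m"
    and "u \<in> mspace (BC UNIV m)"
  shows "(u \<in> AP m \<longleftrightarrow>
            relatively_compactin (mtopology_of (BC UNIV m)) {translate \<tau> u |\<tau>. \<tau> \<ge> 0}) \<and>
         (relatively_compactin (mtopology_of (BC UNIV m)) {translate \<tau> u |\<tau>. \<tau> \<ge> 0} \<longleftrightarrow>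
            relatively_compactin (mtopology_of (BC {0..} m))
              {restrict_nonneg (translate \<tau> u) |\<tau>. \<tau> \<in> UNIV})"
proof -
  have M: "\<And>t. u t \<in> mspace m"
    using BC_in_mspace[OF assms(2)] .
  have "{translate \<tau> u |\<tau>. \<tau> \<ge> 0} = (\<lambda>\<tau>. restrict (translate \<tau> u) UNIV) ` {0..}"
    unfolding restrict_UNIV by blast
  then have ii: "relatively_compactin (mtopology_of (BC UNIV m)) {translate \<tau> u |\<tau>. \<tau> \<ge> 0}
      \<longleftrightarrow> translates_totally_bounded m u UNIV {0..}"
    using relatively_compactin_translates_iff[OF assms, of UNIV "{0..}"] by simp
  have "{restrict_nonneg (translate \<tau> u) |\<tau>. \<tau> \<in> UNIV}
      = (\<lambda>\<tau>. restrict (translate \<tau> u) {0..}) ` UNIV"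
    by (auto simp: restrict_nonneg_def)
  then have iii: "relatively_compactin (mtopology_of (BC {0..} m))
        {restrict_nonneg (translate \<tau> u) |\<tau>. \<tau> \<in> UNIV} \<longleftrightarrow> translates_totally_bounded m u {0..} UNIV"
    using relatively_compactin_translates_iff[OF assms, of "{0..}" UNIV] by simp
  have "translates_totally_bounded m u UNIV UNIV" if "u \<in> AP m"
    using AP_imp_translates_totally_bounded[OF that assms(2)] .
  moreover have "translates_totally_bounded m u UNIV {0..}" "translates_totally_bounded m u {0..} UNIV"
    if "translates_totally_bounded m u UNIV UNIV"
    using translates_totally_bounded_mono[OF that _ M] by simp_all
  moreover have "u \<in> AP m" if "translates_totally_bounded m u UNIV {0..}"
    using nonneg_translates_totally_bounded_imp_AP[OF that assms(2)] .
  moreover have "translates_totally_bounded m u UNIV UNIV" if "translates_totally_bounded m u {0..} UNIV"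
    using forward_imp_two_sided_totally_bounded[OF that M] .
  ultimately show ?thesis unfolding ii iii by blast
qed

end
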